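(* Let $p\ge 2$, and let $\mathcal{S}=\{S_1,\ldots,S_p\}$ and $\mathcal{T}=\{T_1,\ldots,T_p\}$, where $S_k,T_k\subseteq\mathbb{N}$ are nonempty and $|S_k|=|T_k|$ for $1\le k\le p$. Let $s_k^m$ denote the $m$-th element of $S_k$ sorted in increasing order, and define $t_k^m$ similarly for $T_k$ (here $m$ is a superscript index, not a power). If for all $i_1,i_2,\ldots,i_p\in\mathbb{N}$ for which the elements $s_k^{i_k}$ and $t_k^{i_k}$ exist (that is, $i_k\le |S_k|$ whenever $S_k$ is finite), $$\sum_{k=1}^p s_k^{i_k}=\sum_{k=1}^p t_k^{i_k},$$ then the $\mathcal{S}$-limited shift $X(\mathcal{S})$ is conjugate to the $\mathcal{T}$-limited shift $X(\mathcal{T})$.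
   Context: $\mathbb{N}=\{1,2,3,\ldots\}$. For an indexed family $\mathcal{S}=\{S_1,\ldots,S_p\}$ of subsets of $\mathbb{N}$ (repetitions allowed), the core set is $G_{\mathcal{S}}=\{1^{m_1}2^{m_2}\cdots p^{m_p} : m_i\in S_i \text{ for } 1\le i\le p\}$, a set of finite words over $\mathcal{A}=\{1,\ldots,p\}$, where $a^m$ is the letter $a$ repeated $m$ times. The $\mathcal{S}$-limited shift is the subshift $X(\mathcal{S})\subseteq\mathcal{A}^{\mathbb{Z}}$ given by the closure (in the product topology) of the set of all bi-infinite concatenations $\cdots x_{-1}x_0x_1\cdots$ with $x_i\in G_{\mathcal{S}}$ for all $i\in\mathbb{Z}$ (with the origin placed at any coordinate, so the set is shift-invariant). $X(\mathcal{T})$ is defined in the same way. Two subshifts $X,Y$ are conjugate if there is a homeomorphism $\varphi:X\to Y$ with $\varphi\circ\sigma=\sigma\circ\varphi$, where $\sigma$ is the shift map. *)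

theory Defs
  imports "HOL-Analysis.Analysis"
begin

definition full_shift :: "'a set \<Rightarrow> (int \<Rightarrow> 'a) topology" where
  "full_shift A = product_topology (\<lambda>_. discrete_topology A) UNIV"

definition shift :: "(int \<Rightarrow> 'a) \<Rightarrow> int \<Rightarrow> 'a" where
  "shift x = (\<lambda>n. x (n + 1))"

text \<open>Conjugacy of subshifts \<open>X\<close> over the alphabet \<open>A\<close> and \<open>Y\<close> over the alphabet \<open>B\<close>,
  each carrying the subspace topology of its full shift.\<close>

definition conjugate_subshifts ::
  "'a set \<Rightarrow> (int \<Rightarrow> 'a) set \<Rightarrow> 'b set \<Rightarrow> (int \<Rightarrow> 'b) set \<Rightarrow> bool" where
  "conjugate_subshifts A X B Y \<longleftrightarrow>
    (\<exists>\<phi>. homeomorphic_map (subtopology (full_shift A) X) (subtopology (full_shift B) Y) \<phi> \<and>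
         (\<forall>x\<in>X. \<phi> (shift x) = shift (\<phi> x)))"

text \<open>A family \<open>S\<^sub>1, \<dots>, S\<^sub>p\<close> is a function on \<^typ>\<open>nat\<close> of which only the values at
  \<open>1, \<dots>, p\<close> matter.\<close>

definition core_set :: "nat \<Rightarrow> (nat \<Rightarrow> nat set) \<Rightarrow> nat list set" where
  "core_set p S =
    {concat (map (\<lambda>k. replicate (m k) k) [1..<Suc p]) | m. \<forall>k\<in>{1..p}. m k \<in> S k}"

text \<open>The word \<open>w i\<close> occupies the positions from \<open>c i\<close> up to, but not including, \<open>c (i + 1)\<close>.
  No condition is put on \<open>c 0\<close>, so the origin may lie anywhere. The covering condition
  is automatic if all words \<open>w i\<close> are nonempty.\<close>

definition biinfinite_concat :: "(int \<Rightarrow> 'a list) \<Rightarrow> (int \<Rightarrow> 'a) \<Rightarrow> bool" where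
  "biinfinite_concat w x \<longleftrightarrow>
    (\<exists>c :: int \<Rightarrow> int.
       (\<forall>i. c (i + 1) = c i + int (length (w i))) \<and>
       (\<forall>n. \<exists>i. c i \<le> n \<and> n < c (i + 1)) \<and>
       (\<forall>i. map x [c i..c (i + 1) - 1] = w i))"

definition limited_shift :: "nat \<Rightarrow> (nat \<Rightarrow> nat set) \<Rightarrow> (int \<Rightarrow> nat) set" where
  "limited_shift p S =
    full_shift {1..p} closure_of
      {x. \<exists>w. (\<forall>i. w i \<in> core_set p S) \<and> biinfinite_concat w x}"

text \<open>The \<open>m\<close>-th smallest element, counted from \<open>m = 1\<close>, whereas \<^const>\<open>enumerate\<close> counts
  from 0. It is meaningful only for \<open>m \<ge> 1\<close> and, if \<open>S\<close> is finite, \<open>m \<le> card S\<close>.\<close>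

definition nth_element :: "nat set \<Rightarrow> nat \<Rightarrow> nat" where
  "nth_element S m = enumerate S (m - 1)"

end

theory Submission
  imports Defs
begin

text \<open>Varying one index at a time in the hypothesis gives \<open>T\<^sub>k = S\<^sub>k + d\<^sub>k\<close> with
  \<open>d\<^sub>1 + \<dots> + d\<^sub>p = 0\<close>. Moving the boundary between a run of \<open>k\<close> and the following run by
  \<open>D\<^sub>k = d\<^sub>1 + \<dots> + d\<^sub>k\<close> therefore turns concatenations over \<open>S\<close> into concatenations over \<open>T\<close>,
  and the boundaries between \<open>p\<close> and \<open>1\<close> stay in place. The letter at a position changes
  cyclically by the number of boundaries that cross this position, with sign, and this number is
  determined by a window of bounded size. So the map is a sliding block code on the full shift,
  inverted on concatenations by the code for \<open>-D\<close>. Since concatenations are dense and the full shift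
  is Hausdorff, limit points with infinite runs need no separate treatment.\<close>

section \<open>Runs, letters and the sliding block code\<close>

definition letter :: "nat \<Rightarrow> int \<Rightarrow> nat" where
  "letter p j = Suc (nat (j mod int p))"

text \<open>\<open>B j\<close> is the first position of the \<open>j\<close>-th run. Runs are numbered so that those with
  \<open>j mod p = 0\<close> consist of the letter 1.\<close>

definition run_starts :: "nat \<Rightarrow> (nat \<Rightarrow> nat set) \<Rightarrow> (int \<Rightarrow> int) \<Rightarrow> (int \<Rightarrow> nat) \<Rightarrow> bool" where
  "run_starts p S B x \<longleftrightarrow>
    (\<forall>j. B (j + 1) - B j \<in> int ` S (letter p j)) \<and>
    (\<forall>j n. B j \<le> n \<longrightarrow> n < B (j + 1) \<longrightarrow> x n = letter p j)"

text \<open>A boundary is described by its offset \<open>t\<close> from \<open>n\<close>. The two sets contain the boundaries that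
  cross \<open>n\<close> to the right and to the left. Since the run that starts at \<open>n + t\<close> has the letter
  \<open>x (n + t)\<close>, its start moves by \<open>D\<close> of the preceding letter, where the letter \<open>p\<close> counts as 0.\<close>

definition move_runs :: "nat \<Rightarrow> (nat \<Rightarrow> int) \<Rightarrow> int \<Rightarrow> (int \<Rightarrow> nat) \<Rightarrow> int \<Rightarrow> nat" where
  "move_runs p D R x n = letter p (int (x n) - 1
     - int (card {t \<in> {-R..0}. x (n + t - 1) \<noteq> x (n + t) \<and> t + D (x (n + t) - 1) > 0})
     + int (card {t \<in> {0<..R}. x (n + t - 1) \<noteq> x (n + t) \<and> t + D (x (n + t) - 1) \<le> 0}))"

lemma letter_bounds: "p > 0 \<Longrightarrow> letter p j \<in> {1..p}"
  by (simp add: letter_def Suc_le_eq nat_less_iff)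

lemma letter_eq_iff: "p > 0 \<Longrightarrow> letter p i = letter p j \<longleftrightarrow> i mod int p = j mod int p"
  by (simp add: letter_def nat_eq_iff)

text \<open>Here \<open>p \<ge> 2\<close> enters: adjacent runs carry different letters, so the
  boundaries between runs can be read off from a point.\<close>

lemma letter_pred_neq:
  assumes "p \<ge> 2" shows "letter p (i - 1) \<noteq> letter p i"
proof
  assume "letter p (i - 1) = letter p i"
  then have "(i - 1) mod int p = i mod int p"
    using assms by (simp add: letter_eq_iff)
  then have "int p dvd (i - 1) - i"
    by (simp only: mod_eq_dvd_iff)
  then show False
    using assms by simp
qed

section \<open>Increasing integer sequences as partitions of the line\<close>

lemma step_strict_mono:
  fixes B :: "int \<Rightarrow> int"
  assumes "\<And>j. B j < B (j + 1)"
  shows "strict_mono B"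
proof (rule strict_monoI)
  fix i j :: int assume "i < j"
  then show "B i < B j"
    by (induction j rule: int_gr_induct) (use assms in \<open>auto intro: order.strict_trans\<close>)
qed

text \<open>One step to the right or left either stays in the same interval or enters the adjacent
  one, which is nonempty. So induction in both directions from \<open>B 0\<close> reaches every
  position.\<close>

lemma step_covers:
  fixes B :: "int \<Rightarrow> int"
  assumes "\<And>j. B j < B (j + 1)"
  shows "\<exists>j. B j \<le> n \<and> n < B (j + 1)"
proof (induction n rule: int_induct[where k = "B 0"])
  case base
  then show ?case using assms by auto
next
  case (step1 n)
  then obtain j where "B j \<le> n" "n < B (j + 1)" by blast
  then show ?case
    using assms[of "j + 1"] by (cases "n + 1 < B (j + 1)") (force intro: exI[of _ "j + 1"])+
next
  case (step2 n)
  then obtain j where "B j \<le> n" "n < B (j + 1)" by blast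
  then show ?case
    using assms[of "j - 1"] by (cases "B j \<le> n - 1") (force intro: exI[of _ "j - 1"])+
qed

lemma run_starts_step:
  assumes "run_starts p S B x" "p > 0" "\<And>k. k \<in> {1..p} \<Longrightarrow> S k \<subseteq> {1..}"
  shows "B j < B (j + 1)"
proof -
  have "B (j + 1) - B j \<in> int ` S (letter p j)"
    using assms(1) by (simp add: run_starts_def)
  then show ?thesis
    using assms(3)[OF letter_bounds[OF assms(2), of j]] by fastforce
qed

section \<open>Effect of the code on concatenations\<close>

text \<open>If \<open>n\<close> lies in run \<open>j\<close> before the move and in run
  \<open>l\<close> after it, the boundaries crossing \<open>n\<close> to the right are those with
  \<open>l < i \<le> j\<close>, and those crossing to the left have \<open>j < i \<le> l\<close>.
  Counted with sign they give \<open>l - j\<close>, the change of the letter modulo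
  \<open>p\<close>. The bound \<open>R\<close> on the displacements keeps all of them in the
  window.\<close>

lemma move_runs_eq:
  assumes x: "run_starts p S B x" and p: "p \<ge> 2"
    and S: "\<And>k. k \<in> {1..p} \<Longrightarrow> S k \<subseteq> {1..}"
    and R: "\<And>k. k < p \<Longrightarrow> \<bar>D k\<bar> \<le> R"
    and B': "\<And>j. B' j = B j + D (nat (j mod int p))"
    and step': "\<And>j. B' j < B' (j + 1)"
    and l: "B' l \<le> n" "n < B' (l + 1)"
  shows "move_runs p D R x n = letter p l"
proof -
  have p0: "p > 0" using p by simp
  have step: "\<And>j. B j < B (j + 1)"
    using run_starts_step[OF x p0 S] by simp
  have mono: "strict_mono B" and mono': "strict_mono B'"
    using step step' by (auto intro: step_strict_mono)
  obtain j where j: "B j \<le> n" "n < B (j + 1)"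
    using step_covers[of B] step by blast
  have x_at: "x m = letter p i" if "B i \<le> m" "m < B (i + 1)" for i m
    using x that by (simp add: run_starts_def)
  have x_start: "x (B i) = letter p i" for i
    using x_at[of i "B i"] step by simp
  have x_before: "x (B i - 1) = letter p (i - 1)" for i
    using x_at[of "i - 1" "B i - 1"] step[of "i - 1"] by simp
  \<comment> \<open>\<open>x (B i) - 1\<close> is the residue of \<open>i\<close> modulo
    \<open>p\<close>, so the displacement looked up by the code is the one prescribed by
    \<open>B'\<close>.\<close>
  have D_start: "B i + D (x (B i) - 1) = B' i" for i
    by (simp add: x_start B' letter_def)
  have DR: "\<bar>D (x (B i) - 1)\<bar> \<le> R" for i
    using letter_bounds[OF p0, of i] by (intro R) (auto simp: x_start)
  have boundary: "x (b - 1) \<noteq> x b \<longleftrightarrow> b \<in> range B" for b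
  proof
    assume neq: "x (b - 1) \<noteq> x b"
    obtain i where i: "B i \<le> b" "b < B (i + 1)"
      using step_covers[of B] step by blast
    with neq have "b = B i"
      using x_at[of i b] x_at[of i "b - 1"] by force
    then show "b \<in> range B" by simp
  next
    assume "b \<in> range B"
    then show "x (b - 1) \<noteq> x b"
      using letter_pred_neq[OF p] by (auto simp: x_start x_before)
  qed
  have le_j: "B i \<le> n \<longleftrightarrow> i \<le> j" for i
    using j strict_mono_less_eq[OF mono, of i j] strict_mono_less_eq[OF mono, of "j + 1" i] by linarith
  have le_l: "B' i \<le> n \<longleftrightarrow> i \<le> l" for i
    using l strict_mono_less_eq[OF mono', of i l] strict_mono_less_eq[OF mono', of "l + 1" i] by linarith
  have "{t \<in> {-R..0}. x (n + t - 1) \<noteq> x (n + t) \<and> t + D (x (n + t) - 1) > 0}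
      = (\<lambda>i. B i - n) ` {l<..j}" (is "?C1 = _")
  proof (intro equalityI subsetI)
    fix t assume t: "t \<in> ?C1"
    then obtain i where i: "n + t = B i"
      using boundary[of "n + t"] by auto
    with t have "B i \<le> n" "\<not> B' i \<le> n"
      using D_start[of i] by auto
    then show "t \<in> (\<lambda>i. B i - n) ` {l<..j}"
      using i le_j le_l by (intro image_eqI[of _ _ i]) auto
  next
    fix t assume "t \<in> (\<lambda>i. B i - n) ` {l<..j}"
    then obtain i where i: "t = B i - n" "l < i" "i \<le> j" by auto
    then have "B i \<le> n" "\<not> B' i \<le> n"
      using le_j le_l by auto
    then show "t \<in> ?C1"
      using i DR[of i] D_start[of i] boundary[of "B i"] by auto
  qed
  moreover have "{t \<in> {0<..R}. x (n + t - 1) \<noteq> x (n + t) \<and> t + D (x (n + t) - 1) \<le> 0}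
      = (\<lambda>i. B i - n) ` {j<..l}" (is "?C2 = _")
  proof (intro equalityI subsetI)
    fix t assume t: "t \<in> ?C2"
    then obtain i where i: "n + t = B i"
      using boundary[of "n + t"] by auto
    with t have "\<not> B i \<le> n" "B' i \<le> n"
      using D_start[of i] by auto
    then show "t \<in> (\<lambda>i. B i - n) ` {j<..l}"
      using i le_j le_l by (intro image_eqI[of _ _ i]) auto
  next
    fix t assume "t \<in> (\<lambda>i. B i - n) ` {j<..l}"
    then obtain i where i: "t = B i - n" "j < i" "i \<le> l" by auto
    then have "\<not> B i \<le> n" "B' i \<le> n"
      using le_j le_l by auto
    then show "t \<in> ?C2"
      using i DR[of i] D_start[of i] boundary[of "B i"] by auto
  qed
  moreover have "inj_on (\<lambda>i. B i - n) I" for I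
    using strict_mono_imp_inj_on[OF mono] by (auto simp: inj_on_def)
  ultimately have "move_runs p D R x n
      = letter p (int (x n) - 1 - int (nat (j - l)) + int (nat (l - j)))"
    by (simp add: move_runs_def card_image)
  \<comment> \<open>At most one of the two \<open>nat\<close> terms is nonzero, so together they
    contribute \<open>l - j\<close> in either case.\<close>
  also have "int (x n) - 1 - int (nat (j - l)) + int (nat (l - j)) = j mod int p + (l - j)"
    using x_at[OF j] p0 by (simp add: letter_def)
  also have "letter p (j mod int p + (l - j)) = letter p l"
    by (simp add: letter_def mod_simps)
  finally show ?thesis .
qed

text \<open>A run of the letter \<open>Suc k\<close> grows by the displacement of its end minus that
  of its start, \<open>D (Suc k) - D k\<close>, which carries lengths in \<open>S (Suc k)\<close> to
  lengths in \<open>T (Suc k)\<close>. These are positive, so the moved boundaries stay in order and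
  \<open>move_runs_eq\<close> applies.\<close>

lemma run_starts_move_runs:
  assumes x: "run_starts p S B x" and p: "p \<ge> 2"
    and S: "\<And>k. k \<in> {1..p} \<Longrightarrow> S k \<subseteq> {1..}"
    and T: "\<And>k. k \<in> {1..p} \<Longrightarrow> T k \<subseteq> {1..}"
    and R: "\<And>k. k < p \<Longrightarrow> \<bar>D k\<bar> \<le> R"
    and D: "D 0 = 0" "D p = 0"
    and ST: "\<And>k s. k < p \<Longrightarrow> s \<in> S (Suc k) \<Longrightarrow> int s + (D (Suc k) - D k) \<in> int ` T (Suc k)"
  shows "run_starts p T (\<lambda>j. B j + D (nat (j mod int p))) (move_runs p D R x)"
proof -
  define B' where "B' = (\<lambda>j. B j + D (nat (j mod int p)))"
  have p0: "p > 0" using p by simp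
  have length_T: "B' (j + 1) - B' j \<in> int ` T (letter p j)" for j
  proof -
    define k where "k = nat (j mod int p)"
    have k: "k < p" "int k = j mod int p"
      using p0 by (auto simp: k_def nat_less_iff)
    \<comment> \<open>After the letter \<open>p\<close> the residue wraps round to 0; the formula
      survives because \<open>D p\<close> and \<open>D 0\<close> are both 0.\<close>
    have "D (nat ((j + 1) mod int p)) = D (Suc k)"
    proof (cases "Suc k = p")
      case True
      then have "(j + 1) mod int p = 0"
        using k by (metis mod_add_left_eq mod_self of_nat_Suc add.commute)
      then show ?thesis using True D by simp
    next
      case False
      then have "(j + 1) mod int p = int (Suc k)"
        using k p by (metis Suc_lessI mod_add_left_eq mod_less of_nat_Suc of_nat_mod add.commute)
      then show ?thesis by (metis nat_int)
    qed
    moreover obtain s where "s \<in> S (Suc k)" "B (j + 1) - B j = int s"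
      using x unfolding run_starts_def letter_def k_def by blast
    ultimately show ?thesis
      using ST[OF k(1)] by (auto simp: B'_def letter_def algebra_simps simp flip: k_def)
  qed
  have step': "B' j < B' (j + 1)" for j
    using length_T[of j] T[OF letter_bounds[OF p0, of j]] by fastforce
  show ?thesis
    unfolding run_starts_def B'_def[symmetric]
  proof (intro conjI allI impI)
    show "B' (j + 1) - B' j \<in> int ` T (letter p j)" for j
      by (rule length_T)
    show "move_runs p D R x n = letter p j" if "B' j \<le> n" "n < B' (j + 1)" for j n
      by (rule move_runs_eq[where S = S and B = B and B' = B'])
        (use x p S R step' that in \<open>auto simp: B'_def\<close>)
  qed
qed

text \<open>The displacements \<open>- D\<close> return the moved boundaries to \<open>B\<close>, so
  \<open>move_runs_eq\<close> with \<open>B\<close> as the target yields the original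
  letters.\<close>

lemma move_runs_inverse:
  assumes x: "run_starts p S B x" and p: "p \<ge> 2"
    and S: "\<And>k. k \<in> {1..p} \<Longrightarrow> S k \<subseteq> {1..}"
    and T: "\<And>k. k \<in> {1..p} \<Longrightarrow> T k \<subseteq> {1..}"
    and R: "\<And>k. k < p \<Longrightarrow> \<bar>D k\<bar> \<le> R"
    and D: "D 0 = 0" "D p = 0"
    and ST: "\<And>k s. k < p \<Longrightarrow> s \<in> S (Suc k) \<Longrightarrow> int s + (D (Suc k) - D k) \<in> int ` T (Suc k)"
  shows "move_runs p (\<lambda>k. - D k) R (move_runs p D R x) = x"
proof
  fix n
  have p0: "p > 0" using p by simp
  have step: "B j < B (j + 1)" for j
    by (rule run_starts_step[OF x p0 S])
  obtain j where j: "B j \<le> n" "n < B (j + 1)"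
    using step_covers[of B n] step by blast
  have "move_runs p (\<lambda>k. - D k) R (move_runs p D R x) n = letter p j"
    using R step j
    by (intro move_runs_eq[OF run_starts_move_runs[OF x p S T R D ST] p T]) auto
  then show "move_runs p (\<lambda>k. - D k) R (move_runs p D R x) n = x n"
    using x j by (simp add: run_starts_def)
qed

section \<open>Shift equivariance and continuity\<close>

lemma shift_move_runs: "move_runs p D R (shift x) = shift (move_runs p D R x)"
proof
  fix n
  have "shift x (n + t) = x (n + 1 + t)" "shift x (n + t - 1) = x (n + 1 + t - 1)" for t
    by (simp_all add: shift_def algebra_simps)
  moreover have "shift x n = x (n + 1)"
    by (simp add: shift_def)
  ultimately show "move_runs p D R (shift x) n = shift (move_runs p D R x) n"
    unfolding shift_def[of "move_runs p D R x"] move_runs_def by simp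
qed

lemma topspace_full_shift: "topspace (full_shift A) = {x. range x \<subseteq> A}"
  by (auto simp: full_shift_def PiE_UNIV_domain)

text \<open>The points that agree with a given one on \<open>F\<close> form a cylinder, which is
  open because \<open>F\<close> is finite, and \<open>f\<close> is constant on it.\<close>

lemma continuous_map_local_rule:
  fixes f :: "(int \<Rightarrow> 'a) \<Rightarrow> 'b"
  assumes "finite F" and f: "\<And>x. f x \<in> B"
    and local: "\<And>x y. (\<And>i. i \<in> F \<Longrightarrow> x i = y i) \<Longrightarrow> f x = f y"
  shows "continuous_map (full_shift A) (discrete_topology B) f"
  unfolding continuous_map_def
proof (intro conjI allI impI)
  show "f \<in> topspace (full_shift A) \<rightarrow> topspace (discrete_topology B)"
    using f by simp
  fix U assume "openin (discrete_topology B) U"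
  show "openin (full_shift A) {x \<in> topspace (full_shift A). f x \<in> U}" (is "openin _ ?V")
  proof (subst openin_subopen, intro ballI)
    fix x assume x: "x \<in> ?V"
    define C where "C = Pi\<^sub>E UNIV (\<lambda>i. if i \<in> F then {x i} else A)"
    have "openin (full_shift A) C"
      unfolding full_shift_def C_def
      using x \<open>finite F\<close>
      by (subst openin_PiE_gen) (auto simp: topspace_full_shift image_subset_iff
          intro: finite_subset[of _ F])
    moreover have "x \<in> C"
      using x by (auto simp: C_def topspace_full_shift)
    moreover have "C \<subseteq> ?V"
    proof
      fix y assume "y \<in> C"
      then have y: "y i \<in> (if i \<in> F then {x i} else A)" for i
        unfolding C_def by (rule PiE_mem) simp
      have "f y = f x"
      proof (rule local)
        show "y i = x i" if "i \<in> F" for i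
          using y[of i] that by simp
      qed
      moreover have "y i \<in> A" for i
        using y[of i] x by (auto simp: topspace_full_shift split: if_splits)
      ultimately show "y \<in> ?V"
        using x by (auto simp: topspace_full_shift)
    qed
    ultimately show "\<exists>T. openin (full_shift A) T \<and> x \<in> T \<and> T \<subseteq> ?V" by blast
  qed
qed

lemma continuous_move_runs:
  assumes "p > 0"
  shows "continuous_map (full_shift A) (full_shift {1..p}) (move_runs p D R)"
  unfolding full_shift_def[of "{1..p}"] continuous_map_componentwise_UNIV
proof
  fix n
  show "continuous_map (full_shift A) (discrete_topology {1..p}) (\<lambda>x. move_runs p D R x n)"
  proof (rule continuous_map_local_rule)
    \<comment> \<open>The code reads positions \<open>n + t - 1\<close> with
      \<open>t \<ge> -R\<close>, hence the extra \<open>- 1\<close>. The absolute value keeps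
      \<open>n\<close> itself in the window when \<open>R\<close> is negative.\<close>
    show "finite {n - \<bar>R\<bar> - 1..n + \<bar>R\<bar>}" by simp
    show "move_runs p D R x n \<in> {1..p}" for x
      unfolding move_runs_def by (rule letter_bounds[OF assms])
    fix x y :: "int \<Rightarrow> nat"
    assume "\<And>i. i \<in> {n - \<bar>R\<bar> - 1..n + \<bar>R\<bar>} \<Longrightarrow> x i = y i"
    then have "x n = y n" and "\<And>t. t \<in> {-R..0} \<union> {0<..R} \<Longrightarrow>
        x (n + t) = y (n + t) \<and> x (n + t - 1) = y (n + t - 1)"
      by auto
    then show "move_runs p D R x n = move_runs p D R y n"
      unfolding move_runs_def by (simp cong: conj_cong)
  qed
qed

section \<open>Concatenations of core words as sequences of runs\<close>

lemma upto_append: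
  fixes a b c :: int
  assumes "a \<le> b" "b \<le> c"
  shows "[a..c - 1] = [a..b - 1] @ [b..c - 1]"
  using assms upto_split1[of a "b" "c - 1"] by (cases "b = c") auto

lemma map_upto_eq_replicate:
  "map x [a..a + int m - 1] = replicate m k \<longleftrightarrow> (\<forall>n. a \<le> n \<longrightarrow> n < a + int m \<longrightarrow> x n = k)"
proof -
  have "replicate m k = map (\<lambda>_. k) [a..a + int m - 1]"
    by (simp add: map_replicate_const)
  then show ?thesis by (auto simp: Ball_def)
qed

text \<open>Induction on \<open>q\<close> splits off the last block. The positional form on the
  right serves both directions of the passage between words and runs.\<close>

lemma map_upto_eq_runs:
  "map x [c..c + (\<Sum>l=1..q. int (m l)) - 1] = concat (map (\<lambda>k. replicate (m k) k) [1..<Suc q])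
    \<longleftrightarrow> (\<forall>r<q. \<forall>n. c + (\<Sum>l=1..r. int (m l)) \<le> n \<longrightarrow> n < c + (\<Sum>l=1..Suc r. int (m l)) \<longrightarrow> x n = Suc r)"
proof (induction q)
  case 0
  then show ?case by simp
next
  case (Suc q)
  let ?s = "\<lambda>q. c + (\<Sum>l=1..q. int (m l))"
  have len: "length (concat (map (\<lambda>k. replicate (m k) k) [1..<Suc q])) = (\<Sum>l=1..q. m l)"
    by (induction q) (simp_all add: length_concat)
  have s_Suc: "?s (Suc q) = ?s q + int (m (Suc q))"
    by simp
  have "[c..?s (Suc q) - 1] = [c..?s q - 1] @ [?s q..?s (Suc q) - 1]"
    by (rule upto_append) (simp_all add: sum_nonneg)
  moreover have "[1..<Suc (Suc q)] = [1..<Suc q] @ [Suc q]"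
    by simp
  ultimately have "map x [c..?s (Suc q) - 1] = concat (map (\<lambda>k. replicate (m k) k) [1..<Suc (Suc q)])
      \<longleftrightarrow> map x [c..?s q - 1] = concat (map (\<lambda>k. replicate (m k) k) [1..<Suc q]) \<and>
          map x [?s q..?s (Suc q) - 1] = replicate (m (Suc q)) (Suc q)"
    using len by (simp only: map_append concat_append) (subst append_eq_append_conv, auto)
  also have "\<dots> \<longleftrightarrow> (\<forall>r<Suc q. \<forall>n. ?s r \<le> n \<longrightarrow> n < ?s (Suc r) \<longrightarrow> x n = Suc r)"
    unfolding Suc.IH s_Suc map_upto_eq_replicate by (auto simp: less_Suc_eq)
  finally show ?case .
qed

text \<open>Each core word contributes \<open>p\<close> consecutive runs, and run \<open>j\<close>
  is number \<open>j mod p\<close>, counted from 0, of word \<open>j div p\<close>. Conversely,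
  cutting before every run of the letter 1 recovers the words.\<close>

lemma biinfinite_concat_iff_run_starts:
  assumes p: "p > 0" and S: "\<And>k. k \<in> {1..p} \<Longrightarrow> S k \<subseteq> {1..}"
  shows "(\<exists>w. (\<forall>i. w i \<in> core_set p S) \<and> biinfinite_concat w x) \<longleftrightarrow> (\<exists>B. run_starts p S B x)"
proof
  assume "\<exists>w. (\<forall>i. w i \<in> core_set p S) \<and> biinfinite_concat w x"
  then obtain w where w: "\<And>i. w i \<in> core_set p S" and "biinfinite_concat w x"
    by blast
  then obtain c where "\<forall>i. c (i + 1) = c i + int (length (w i))"
    and "\<forall>i. map x [c i..c (i + 1) - 1] = w i"
    unfolding biinfinite_concat_def by blast
  then have c: "c (i + 1) = c i + int (length (w i))"
    and x: "map x [c i..c (i + 1) - 1] = w i" for i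
    by blast+
  have "\<forall>i. \<exists>m. w i = concat (map (\<lambda>k. replicate (m k) k) [1..<Suc p]) \<and> (\<forall>k\<in>{1..p}. m k \<in> S k)"
    using w unfolding core_set_def by blast
  then have "\<exists>m. \<forall>i. w i = concat (map (\<lambda>k. replicate (m i k) k) [1..<Suc p]) \<and> (\<forall>k\<in>{1..p}. m i k \<in> S k)"
    by (rule choice)
  then obtain m where m: "\<And>i. w i = concat (map (\<lambda>k. replicate (m i k) k) [1..<Suc p])"
    "\<And>i k. k \<in> {1..p} \<Longrightarrow> m i k \<in> S k"
    by blast
  have len: "length (w i) = (\<Sum>l=1..p. m i l)" for i
    unfolding m(1) by (simp add: length_concat comp_def interv_sum_list_conv_sum_set_nat
        atLeastLessThanSuc_atLeastAtMost flip: One_nat_def del: upt_Suc)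
  define B where "B j = c (j div int p) + (\<Sum>l=1..nat (j mod int p). int (m (j div int p) l))" for j
  \<comment> \<open>The end of run \<open>j\<close> is expressed within its own word, even if run
    \<open>j + 1\<close> opens the next word; the sum is then the full word length.\<close>
  have B_Suc: "B (j + 1) = c (j div int p) + (\<Sum>l=1..letter p j. int (m (j div int p) l))" for j
  proof -
    define i where "i = j div int p"
    define k where "k = nat (j mod int p)"
    have k: "k < p" "j = i * int p + int k"
      using p by (auto simp: k_def i_def nat_less_iff)
    show ?thesis
    proof (cases "Suc k = p")
      case True
      then have "j + 1 = (i + 1) * int p"
        using k by (simp add: algebra_simps flip: of_nat_Suc)
      then have "B (j + 1) = c (i + 1)"
        using p by (simp add: B_def)
      then show ?thesis
        using c[of i] len[of i] True by (simp add: letter_def flip: i_def k_def)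
    next
      case False
      then have "(j + 1) div int p = i" "(j + 1) mod int p = int (Suc k)"
        using k by (simp_all add: add.assoc flip: of_nat_Suc)
      then show ?thesis
        by (simp add: B_def letter_def nat_add_distrib flip: i_def k_def)
    qed
  qed
  have "run_starts p S B x"
    unfolding run_starts_def
  proof (intro conjI allI impI)
    fix j
    show "B (j + 1) - B j \<in> int ` S (letter p j)"
      unfolding B_Suc using m(2)[OF letter_bounds[OF p]] by (simp add: B_def letter_def)
    fix n assume n: "B j \<le> n" "n < B (j + 1)"
    let ?i = "j div int p" and ?k = "nat (j mod int p)"
    have "map x [c ?i..c ?i + (\<Sum>l=1..p. int (m ?i l)) - 1]
        = concat (map (\<lambda>k. replicate (m ?i k) k) [1..<Suc p])"
      using x[of ?i] unfolding c[of ?i] len[of ?i] m(1)[of ?i, symmetric] of_nat_sum .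
    moreover have "?k < p"
      using p by (simp add: nat_less_iff)
    ultimately show "x n = letter p j"
      using n unfolding map_upto_eq_runs B_Suc by (simp add: B_def letter_def)
  qed
  then show "\<exists>B. run_starts p S B x"
    by blast
next
  assume "\<exists>B. run_starts p S B x"
  then obtain B where B: "run_starts p S B x" ..
  have step: "B j < B (j + 1)" for j
    by (rule run_starts_step[OF B p S])
  define c where "c i = B (i * int p)" for i
  \<comment> \<open>Letters are counted from 1 and runs from 0, so letter \<open>k\<close> of word
    \<open>i\<close> fills run \<open>i * p + k - 1\<close>.\<close>
  define m where "m i k = nat (B (i * int p + int k) - B (i * int p + int k - 1))" for i k
  define w where "w i = map x [c i..c (i + 1) - 1]" for i
  have sum_m: "c i + (\<Sum>l=1..r. int (m i l)) = B (i * int p + int r)" for i r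
  proof (induction r)
    case 0
    then show ?case by (simp add: c_def)
  next
    case (Suc r)
    then show ?case
      using step[of "i * int p + int r"] by (simp add: m_def algebra_simps)
  qed
  have letter_block: "letter p (i * int p + int r) = Suc r" if "r < p" for i r
    using that by (simp add: letter_def)
  have "w i \<in> core_set p S" for i
  proof -
    have "x n = Suc r" if "r < p" "B (i * int p + int r) \<le> n" "n < B (i * int p + int (Suc r))" for r n
      using B letter_block[of r i] that by (auto simp: run_starts_def algebra_simps)
    then have "map x [c i..c i + (\<Sum>l=1..p. int (m i l)) - 1]
        = concat (map (\<lambda>k. replicate (m i k) k) [1..<Suc p])"
      unfolding map_upto_eq_runs unfolding sum_m by blast
    moreover have "c (i + 1) = c i + (\<Sum>l=1..p. int (m i l))"
      unfolding sum_m by (simp add: c_def algebra_simps)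
    ultimately have "w i = concat (map (\<lambda>k. replicate (m i k) k) [1..<Suc p])"
      unfolding w_def by (simp only:)
    moreover have "m i k \<in> S k" if k: "k \<in> {1..p}" for k
    proof -
      obtain r where r: "k = Suc r" "r < p"
        using k by (cases k) auto
      have "B (i * int p + int r + 1) - B (i * int p + int r) \<in> int ` S k"
        using B letter_block[OF r(2), of i] r(1) by (metis run_starts_def)
      then show ?thesis
        by (auto simp: m_def r(1) algebra_simps)
    qed
    ultimately show ?thesis
      unfolding core_set_def by blast
  qed
  moreover have "biinfinite_concat w x"
    unfolding biinfinite_concat_def
  proof (intro exI[of _ c] conjI allI)
    have c_step: "c i < c (i + 1)" for i
      using step_strict_mono[of B, OF step] p by (simp add: c_def strict_mono_less)
    show "c (i + 1) = c i + int (length (w i))" for i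
      using c_step[of i] by (simp add: w_def)
    show "\<exists>i. c i \<le> n \<and> n < c (i + 1)" for n
      using step_covers[of c] c_step by blast
    show "map x [c i..c (i + 1) - 1] = w i" for i
      by (simp add: w_def)
  qed
  ultimately show "\<exists>w. (\<forall>i. w i \<in> core_set p S) \<and> biinfinite_concat w x" by blast
qed

section \<open>Passage to closures and the conjugacy\<close>

lemma limited_shift_eq:
  assumes "p > 0" "\<And>k. k \<in> {1..p} \<Longrightarrow> S k \<subseteq> {1..}"
  shows "limited_shift p S = full_shift {1..p} closure_of {x. \<exists>B. run_starts p S B x}"
  unfolding limited_shift_def using biinfinite_concat_iff_run_starts[OF assms] by simp

text \<open>By continuity the closure of the concatenations over \<open>S\<close> goes into the
  closure of their images, which are concatenations over \<open>T\<close>. The code followed by the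
  code for \<open>- D\<close> and the identity are continuous into a Hausdorff space and agree on
  concatenations, hence on the closure.\<close>

lemma limited_shift_move_runs:
  assumes p: "p \<ge> 2"
    and S: "\<And>k. k \<in> {1..p} \<Longrightarrow> S k \<subseteq> {1..}"
    and T: "\<And>k. k \<in> {1..p} \<Longrightarrow> T k \<subseteq> {1..}"
    and R: "\<And>k. k < p \<Longrightarrow> \<bar>D k\<bar> \<le> R"
    and D: "D 0 = 0" "D p = 0"
    and ST: "\<And>k s. k < p \<Longrightarrow> s \<in> S (Suc k) \<Longrightarrow> int s + (D (Suc k) - D k) \<in> int ` T (Suc k)"
    and x: "x \<in> limited_shift p S"
  shows "move_runs p D R x \<in> limited_shift p T"
    and "move_runs p (\<lambda>k. - D k) R (move_runs p D R x) = x"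
proof -
  have p0: "p > 0" using p by simp
  note cont = continuous_move_runs[OF p0]
  have x': "x \<in> full_shift {1..p} closure_of {x. \<exists>B. run_starts p S B x}"
    using x limited_shift_eq[where S = S, OF p0 S] by simp
  have "move_runs p D R ` {x. \<exists>B. run_starts p S B x} \<subseteq> {x. \<exists>B. run_starts p T B x}"
    using run_starts_move_runs[where S = S and T = T and D = D and R = R, OF _ p S T R D ST] by blast
  then show "move_runs p D R x \<in> limited_shift p T"
    using continuous_map_image_closure_subset[OF cont[of "{1..p}" D R], of "{x. \<exists>B. run_starts p S B x}"]
      closure_of_mono[of "move_runs p D R ` {x. \<exists>B. run_starts p S B x}"
        "{x. \<exists>B. run_starts p T B x}" "full_shift {1..p}"]
      x' limited_shift_eq[where S = T, OF p0 T]
    by auto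
  have "continuous_map (full_shift {1..p}) (full_shift {1..p})
      (\<lambda>x. move_runs p (\<lambda>k. - D k) R (move_runs p D R x))"
    using continuous_map_compose[OF cont[of "{1..p}" D R] cont[of "{1..p}" "\<lambda>k. - D k" R]]
    by (simp only: comp_def)
  moreover have "Hausdorff_space (full_shift {1..p})"
    by (simp add: full_shift_def Hausdorff_space_product_topology)
  moreover have "continuous_map (full_shift {1..p}) (full_shift {1..p}) (\<lambda>x. x)"
    by simp
  moreover have "move_runs p (\<lambda>k. - D k) R (move_runs p D R y) = y"
    if "y \<in> {x. \<exists>B. run_starts p S B x}" for y
    using that move_runs_inverse[where S = S and T = T and D = D and R = R, OF _ p S T R D ST]
    by blast
  ultimately show "move_runs p (\<lambda>k. - D k) R (move_runs p D R x) = x"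
    using forall_in_closure_of_eq[OF x', of "full_shift {1..p}"
        "\<lambda>x. move_runs p (\<lambda>k. - D k) R (move_runs p D R x)" "\<lambda>x. x"] by blast
qed

text \<open>The hypotheses of \<open>limited_shift_move_runs\<close> persist when \<open>S\<close>
  and \<open>T\<close> are exchanged and \<open>D\<close> is negated, so that lemma yields both the
  map and its two-sided inverse.\<close>

lemma conjugate_limited_shifts_translate:
  assumes p: "p \<ge> 2"
    and S: "\<And>k. k \<in> {1..p} \<Longrightarrow> S k \<subseteq> {1..}"
    and T: "\<And>k. k \<in> {1..p} \<Longrightarrow> T k \<subseteq> {1..}"
    and d: "\<And>k. k \<in> {1..p} \<Longrightarrow> int ` T k = (\<lambda>s. int s + d k) ` S k"
    and sum_d: "(\<Sum>k=1..p. d k) = 0"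
  shows "conjugate_subshifts {1..p} (limited_shift p S) {1..p} (limited_shift p T)"
proof -
  define D where "D r = (\<Sum>k=1..r. d k)" for r :: nat
  define R where "R = (\<Sum>k<p. \<bar>D k\<bar>)"
  define \<phi> where "\<phi> = move_runs p D R"
  define \<psi> where "\<psi> = move_runs p (\<lambda>k. - D k) R"
  have p0: "p > 0" using p by simp
  have R: "\<bar>D k\<bar> \<le> R" if "k < p" for k
    unfolding R_def using that by (intro member_le_sum) auto
  have D: "D 0 = 0" "D p = 0"
    using sum_d by (simp_all add: D_def)
  have ST: "int s + (D (Suc k) - D k) \<in> int ` T (Suc k)" if "k < p" "s \<in> S (Suc k)" for k s
    using that d[of "Suc k"] by (auto simp: D_def)
  have TS: "int t + (- D (Suc k) - - D k) \<in> int ` S (Suc k)" if "k < p" "t \<in> T (Suc k)" for k t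
  proof -
    have "int t \<in> (\<lambda>s. int s + d (Suc k)) ` S (Suc k)"
      using that d[of "Suc k"] by (metis atLeastAtMost_iff imageI le_add1 plus_1_eq_Suc Suc_leI)
    then show ?thesis by (auto simp: D_def)
  qed
  note \<phi> = limited_shift_move_runs[where S = S and T = T and D = D and R = R, OF p S T R D ST,
      folded \<phi>_def \<psi>_def]
  have \<psi>: "\<psi> y \<in> limited_shift p S" "\<phi> (\<psi> y) = y" if "y \<in> limited_shift p T" for y
    using limited_shift_move_runs[of p T S "\<lambda>k. - D k" R y] p S T R D TS that
    by (simp_all add: \<phi>_def \<psi>_def)
  have "homeomorphic_maps (subtopology (full_shift {1..p}) (limited_shift p S))
      (subtopology (full_shift {1..p}) (limited_shift p T)) \<phi> \<psi>"
    unfolding homeomorphic_maps_def continuous_map_in_subtopology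
    using \<phi> \<psi> continuous_move_runs[OF p0]
    by (auto simp: \<phi>_def \<psi>_def intro: continuous_map_from_subtopology)
  then show ?thesis
    unfolding conjugate_subshifts_def homeomorphic_map_maps
    using shift_move_runs by (auto simp: \<phi>_def)
qed

section \<open>From equal sums to translated sets\<close>

text \<open>This turns an identity between \<open>m\<close>-th elements, valid for all admissible
  \<open>m\<close>, into an equality of sets.\<close>

lemma nth_element_valid_range:
  "nth_element S ` {m. m \<ge> 1 \<and> (finite S \<longrightarrow> m \<le> card S)} = S"
proof -
  have "nth_element S m \<in> S" if "m \<ge> 1" "finite S \<longrightarrow> m \<le> card S" for m
    using that by (cases "finite S")
      (auto simp: nth_element_def enumerate_in_set intro!: finite_enumerate_in_set)
  moreover have "\<exists>m\<ge>1. (finite S \<longrightarrow> m \<le> card S) \<and> nth_element S m = s" if "s \<in> S" for s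
  proof -
    have "\<exists>n. (finite S \<longrightarrow> n < card S) \<and> enumerate S n = s"
      using that finite_enumerate_Ex[of S s] enumerate_Ex[of S s] by (cases "finite S") auto
    then obtain n where "finite S \<longrightarrow> n < card S" "enumerate S n = s" by blast
    then show ?thesis
      by (intro exI[of _ "Suc n"]) (auto simp: nth_element_def)
  qed
  ultimately show ?thesis by blast
qed

theorem theorem5p2:
  fixes p :: nat and S T :: "nat \<Rightarrow> nat set"
  assumes "p \<ge> 2"
    and "\<And>k. k \<in> {1..p} \<Longrightarrow> S k \<subseteq> {1..} \<and> S k \<noteq> {}"
    and "\<And>k. k \<in> {1..p} \<Longrightarrow> T k \<subseteq> {1..} \<and> T k \<noteq> {}"
    and "\<And>k. k \<in> {1..p} \<Longrightarrow> S k \<approx> T k"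
    and "\<And>i :: nat \<Rightarrow> nat.
           (\<forall>k\<in>{1..p}. i k \<ge> 1 \<and> (finite (S k) \<longrightarrow> i k \<le> card (S k))) \<Longrightarrow>
           (\<Sum>k=1..p. nth_element (S k) (i k)) = (\<Sum>k=1..p. nth_element (T k) (i k))"
  shows "conjugate_subshifts {1..p} (limited_shift p S) {1..p} (limited_shift p T)"
proof -
  define e where "e k m = int (nth_element (T k) m) - int (nth_element (S k) m)" for k m
  define I where "I k = {m. m \<ge> 1 \<and> (finite (S k) \<longrightarrow> m \<le> card (S k))}" for k
  have I_T: "I k = {m. m \<ge> 1 \<and> (finite (T k) \<longrightarrow> m \<le> card (T k))}" if "k \<in> {1..p}" for k
    using assms(4)[OF that] eqpoll_finite_iff[of "S k" "T k"] eqpoll_iff_card[of "S k" "T k"]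
    by (auto simp: I_def)
  \<comment> \<open>Since every set is nonempty, 1 is always admissible and can serve as the fixed
    index in the other coordinates.\<close>
  have one: "1 \<in> I k" if "k \<in> {1..p}" for k
    using assms(2)[OF that] by (auto simp: I_def card_gt_0_iff Suc_le_eq)
  have sum_e: "(\<Sum>k=1..p. e k (i k)) = 0" if "\<And>k. k \<in> {1..p} \<Longrightarrow> i k \<in> I k" for i
    using assms(5)[of i] that unfolding e_def I_def sum_subtractf
    by (simp flip: of_nat_sum)
  \<comment> \<open>Changing only the \<open>k\<close>-th index from 1 to \<open>m\<close> keeps the
    sum of the differences at 0, so the \<open>k\<close>-th difference is independent of the
    index.\<close>
  have e: "e k m = e k 1" if k: "k \<in> {1..p}" and m: "m \<in> I k" for k m
  proof -
    have "(\<Sum>l=1..p. e l (((\<lambda>_. 1)(k := m)) l)) = (\<Sum>l=1..p. e l 1)"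
      using one m sum_e[of "(\<lambda>_. 1)(k := m)"] sum_e[of "\<lambda>_. 1"] by simp
    moreover have "(\<Sum>l\<in>{1..p} - {k}. e l (((\<lambda>_. 1)(k := m)) l)) = (\<Sum>l\<in>{1..p} - {k}. e l 1)"
      by (rule sum.cong) auto
    ultimately show ?thesis
      using k sum.remove[of "{1..p}" k "\<lambda>l. e l (((\<lambda>_. 1)(k := m)) l)"]
        sum.remove[of "{1..p}" k "\<lambda>l. e l 1"] by (simp del: fun_upd_apply) simp
  qed
  have "int ` T k = (\<lambda>s. int s + e k 1) ` S k" if k: "k \<in> {1..p}" for k
  proof -
    have "nth_element (T k) ` I k = T k"
      unfolding I_T[OF k] by (rule nth_element_valid_range)
    then have "int ` T k = (\<lambda>m. int (nth_element (T k) m)) ` I k"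
      by (metis image_image)
    also have "\<dots> = (\<lambda>m. int (nth_element (S k) m) + e k 1) ` I k"
      using e[OF k] by (intro image_cong) (auto simp: e_def algebra_simps)
    also have "\<dots> = (\<lambda>s. int s + e k 1) ` nth_element (S k) ` I k"
      by (simp add: image_image)
    also have "nth_element (S k) ` I k = S k"
      unfolding I_def by (rule nth_element_valid_range)
    finally show ?thesis .
  qed
  then show ?thesis
    using assms(1-3) sum_e[of "\<lambda>_. 1"] one
    by (intro conjugate_limited_shifts_translate[where d = "\<lambda>k. e k 1"]) auto
qed

end
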